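(* Let $x$ be a real number with $x>1/3$ and let $z\in\mathbb{C}$ satisfy $|z|>|\lambda_1(x)|$, where $\lambda_1(x)=3x+\sqrt{9x^2-1}$. Then $$\sum_{n=0}^\infty \frac{(-1)^{n}}{2n+1}\frac{B_{2n+1}(x)}{z^{2n+1}} = \frac{1}{2\sqrt{9x^2-1}}\arctan\Big (\frac{2\sqrt{9x^2-1}\,z}{z^2+1}\Big )$$ and $$\sum_{n=0}^\infty \frac{(-1)^{n}}{2n+1}\frac{C_{2n+1}(x)}{z^{2n+1}} = \frac{1}{2}\arctan\Big (\frac{6xz}{z^2-1}\Big ).$$
   Context: The balancing polynomials $(B_n(x))_{n\ge 0}$ and Lucas-balancing polynomials $(C_n(x))_{n\ge 0}$ both satisfy the recurrence $u_n(x)=6x\,u_{n-1}(x)-u_{n-2}(x)$ for $n\ge 2$, with initial terms $B_0(x)=0$, $B_1(x)=1$ and $C_0(x)=1$, $C_1(x)=3x$. Here $\arctan$ denotes the principal branch of the (complex) arctangent. *)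

theory Defs
  imports "HOL-Analysis.Complex_Transcendental" "HOL-Computational_Algebra.Polynomial"
begin

fun balancing_poly :: "nat \<Rightarrow> real poly" where
  "balancing_poly 0 = 0"
| "balancing_poly (Suc 0) = 1"
| "balancing_poly (Suc (Suc n)) = [:0, 6:] * balancing_poly (Suc n) - balancing_poly n"

fun lucas_balancing_poly :: "nat \<Rightarrow> real poly" where
  "lucas_balancing_poly 0 = 1"
| "lucas_balancing_poly (Suc 0) = [:0, 3:]"
| "lucas_balancing_poly (Suc (Suc n)) =
     [:0, 6:] * lucas_balancing_poly (Suc n) - lucas_balancing_poly n"

definition lambda1 :: "real \<Rightarrow> real" where
  "lambda1 x = 3 * x + sqrt (9 * x ^ 2 - 1)"

end

(* With l1, l2 = 3 x +- sqrt (9 x^2 - 1), so that l1 l2 = 1, the Binet formulas turn the two series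
   into a difference and a sum of the arctangent series at l1 / z and l2 / z, both inside the unit
   disc.  On the unit disc |Re (Arctan w)| < pi / 4, so the addition theorem holds for the principal
   branch. *)
theory Submission
  imports Defs
begin

text \<open>The real part of \<open>cos z\<close> is cos (Re z) cosh (Im z), and both factors are
  positive in this strip.\<close>

lemma cos_nonzero_strip:
  fixes z :: complex
  assumes "\<bar>Re z\<bar> < pi / 2"
  shows "cos z \<noteq> 0"
proof -
  have "0 < cos (Re z)"
    using assms by (intro cos_gt_zero_pi) auto
  moreover have "0 < exp (Im z) + exp (- Im z)"
    by (intro add_pos_pos) auto
  ultimately have "Re (cos z) \<noteq> 0"
    by (simp add: Re_cos)
  then show ?thesis
    by auto
qed

text \<open>Excludes the points i and -i, as \<open>tan_Arctan\<close> requires.\<close>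

lemma square_neq_minus_one:
  fixes z :: complex
  assumes "norm z < 1"
  shows "z\<^sup>2 \<noteq> -1"
proof
  assume "z\<^sup>2 = -1"
  then have "norm z ^ 2 = 1"
    by (metis norm_minus_cancel norm_one norm_power)
  with power_strict_mono[OF assms norm_ge_zero, of 2] show False
    by simp
qed

text \<open>The Moebius map under the logarithm in \<open>Arctan_def\<close> sends the unit disc
  into the right half-plane, where the imaginary part of \<open>Ln\<close> stays below pi / 2 in
  absolute value. The prefactor i / 2 halves this bound.\<close>

lemma abs_Re_Arctan_less_pi_quarter:
  assumes "norm z < 1"
  shows "\<bar>Re (Arctan z)\<bar> < pi / 4"
proof -
  have "\<bar>Im (Ln ((1 - \<i>*z) / (1 + \<i>*z)))\<bar> < pi / 2"
    using assms by (intro Re_Ln_pos_lt_imp) (simp only: Re_complex_div_lemma)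
  then show ?thesis
    by (simp add: Arctan_def)
qed

text \<open>The two bounds pi / 4 keep the sum inside the strip where \<open>Arctan\<close> inverts
  \<open>tan\<close>, so no multiple of pi has to be corrected. The three nonzero cosines license
  the addition formula for \<open>tan\<close>.\<close>

lemma Arctan_add:
  assumes "norm a < 1" and "norm b < 1"
  shows "Arctan a + Arctan b = Arctan ((a + b) / (1 - a * b))"
proof -
  have bounds: "\<bar>Re (Arctan a)\<bar> < pi / 4" "\<bar>Re (Arctan b)\<bar> < pi / 4"
    using assms by (simp_all only: abs_Re_Arctan_less_pi_quarter)
  then have strip: "\<bar>Re (Arctan a + Arctan b)\<bar> < pi / 2"
    unfolding plus_complex.sel by linarith
  have "cos (Arctan a) \<noteq> 0" "cos (Arctan b) \<noteq> 0" "cos (Arctan a + Arctan b) \<noteq> 0"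
    using bounds strip by (auto intro!: cos_nonzero_strip)
  then have "tan (Arctan a + Arctan b) = (a + b) / (1 - a * b)"
    by (simp only: tan_add tan_Arctan square_neq_minus_one assms not_False_eq_True)
  then show ?thesis
    using Arctan_tan[OF strip] by simp
qed

lemma Arctan_minus:
  assumes "norm a < 1"
  shows "Arctan (- a) = - Arctan a"
  using Arctan_add[of a "- a"] assms by (simp add: eq_neg_iff_add_eq_0 add.commute)

lemma Arctan_diff:
  assumes "norm a < 1" and "norm b < 1"
  shows "Arctan a - Arctan b = Arctan ((a - b) / (1 + a * b))"
  using Arctan_add[of a "- b"] assms by (simp add: Arctan_minus)

text \<open>Multiply the characteristic equation by \<open>l ^ n\<close>: powers of a root obey the
  recurrence of both polynomial families.\<close>

lemma power_recurrence:
  fixes l :: real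
  assumes "l\<^sup>2 = 6 * x * l - 1"
  shows "l ^ Suc (Suc n) = 6 * x * l ^ Suc n - l ^ n"
proof -
  have "l ^ Suc (Suc n) = l ^ n * l\<^sup>2"
    by (simp add: power2_eq_square)
  then show ?thesis
    by (simp add: assms algebra_simps)
qed

text \<open>Both sides obey the same recurrence and agree for n = 0 and n = 1. The factor
  \<open>l - m\<close> stays on the left to avoid a division.\<close>

lemma balancing_poly_binet:
  fixes l m x :: real
  assumes "l\<^sup>2 = 6 * x * l - 1" and "m\<^sup>2 = 6 * x * m - 1"
  shows "(l - m) * poly (balancing_poly n) x = l ^ n - m ^ n"
proof (induction n rule: balancing_poly.induct)
  case (3 n)
  have "(l - m) * poly (balancing_poly (Suc (Suc n))) x
      = 6 * x * ((l - m) * poly (balancing_poly (Suc n)) x) - (l - m) * poly (balancing_poly n) x"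
    by (simp add: algebra_simps)
  also have "\<dots> = 6 * x * (l ^ Suc n - m ^ Suc n) - (l ^ n - m ^ n)"
    by (simp only: 3)
  finally show ?case
    unfolding power_recurrence[OF assms(1)] power_recurrence[OF assms(2)]
    by (simp add: algebra_simps)
qed auto

text \<open>Same induction; the sum of the roots enters in the base case n = 1.\<close>

lemma lucas_balancing_poly_binet:
  fixes l m x :: real
  assumes "l\<^sup>2 = 6 * x * l - 1" and "m\<^sup>2 = 6 * x * m - 1" and "l + m = 6 * x"
  shows "2 * poly (lucas_balancing_poly n) x = l ^ n + m ^ n"
proof (induction n rule: lucas_balancing_poly.induct)
  case (3 n)
  have "2 * poly (lucas_balancing_poly (Suc (Suc n))) x
      = 6 * x * (2 * poly (lucas_balancing_poly (Suc n)) x) - 2 * poly (lucas_balancing_poly n) x"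
    by (simp add: algebra_simps)
  also have "\<dots> = 6 * x * (l ^ Suc n + m ^ Suc n) - (l ^ n + m ^ n)"
    by (simp only: 3)
  finally show ?case
    unfolding power_recurrence[OF assms(1)] power_recurrence[OF assms(2)]
    by (simp add: algebra_simps)
qed (use assms(3) in auto)

theorem theorem1:
  fixes x :: real and z :: complex
  assumes "x > 1 / 3"
    and "norm z > \<bar>lambda1 x\<bar>"
  shows "((\<lambda>n. (- 1) ^ n / of_nat (2 * n + 1)
            * (complex_of_real (poly (balancing_poly (2 * n + 1)) x) / z ^ (2 * n + 1)))
          sums (1 / (2 * complex_of_real (sqrt (9 * x ^ 2 - 1)))
            * Arctan (2 * complex_of_real (sqrt (9 * x ^ 2 - 1)) * z / (z ^ 2 + 1))))
      \<and> ((\<lambda>n. (- 1) ^ n / of_nat (2 * n + 1)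
            * (complex_of_real (poly (lucas_balancing_poly (2 * n + 1)) x) / z ^ (2 * n + 1)))
          sums (1 / 2 * Arctan (6 * complex_of_real x * z / (z ^ 2 - 1))))"
proof -
  define s where "s = sqrt (9 * x\<^sup>2 - 1)"
  define l m where "l = 3 * x + s" and "m = 3 * x - s"
  have "(1 / 3)\<^sup>2 < x\<^sup>2"
    using assms(1) by (intro power_strict_mono) auto
  then have pos: "0 < 9 * x\<^sup>2 - 1"
    by (simp add: power2_eq_square)
  then have s: "0 < s" "s\<^sup>2 = 9 * x\<^sup>2 - 1"
    by (simp_all add: s_def)
  have lm: "l * m = 1" "l + m = 6 * x" "l - m = 2 * s"
    using s(2) by (simp_all add: l_def m_def algebra_simps power2_eq_square)
  have roots: "l\<^sup>2 = 6 * x * l - 1" "m\<^sup>2 = 6 * x * m - 1"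
    using s(2) by (simp_all add: l_def m_def algebra_simps power2_eq_square)
  have "1 < l"
    using assms(1) s(1) by (simp add: l_def)
  \<comment> \<open>Positivity of \<open>m\<close> gives \<open>b\<close> the norm
    \<open>m / norm z\<close>.\<close>
  then have "0 < m"
    using lm(1) by (metis less_trans zero_less_mult_pos zero_less_one)
  have "l < norm z"
    using assms(2) by (simp add: lambda1_def l_def s_def)
  then have z: "1 < norm z" "z \<noteq> 0"
    using \<open>1 < l\<close> by auto
  define a b where "a = of_real l / z" and "b = of_real m / z"
  have "m < norm z"
    using \<open>l < norm z\<close> lm(3) s(1) by linarith
  then have ab: "norm a < 1" "norm b < 1"
    using \<open>l < norm z\<close> \<open>1 < l\<close> \<open>0 < m\<close> z by (simp_all add: a_def b_def norm_divide)
  have z2: "z\<^sup>2 + 1 \<noteq> 0" "z\<^sup>2 - 1 \<noteq> 0"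
  proof -
    \<comment> \<open>A zero of either denominator would make z^2 equal to -1 or 1, of norm
      1.\<close>
    have "norm (z\<^sup>2) \<noteq> 1"
      using z by (simp add: norm_power power2_eq_1_iff)
    then show "z\<^sup>2 + 1 \<noteq> 0" "z\<^sup>2 - 1 \<noteq> 0"
      by (auto simp: add_eq_0_iff2 norm_minus_cancel)
  qed
  \<comment> \<open>Because l m = 1, the denominators 1 + a b and 1 - a b of the addition theorem
    become (z^2 + 1) / z^2 and (z^2 - 1) / z^2.\<close>
  have prod: "a * b = 1 / z\<^sup>2"
    using lm(1) by (simp add: a_def b_def power2_eq_square flip: of_real_mult)
  have diff: "a - b = 2 * of_real s / z"
    using lm(3) by (simp add: a_def b_def flip: diff_divide_distrib of_real_diff)
  have sum: "a + b = 6 * of_real x / z"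
    using lm(2) by (simp add: a_def b_def flip: add_divide_distrib of_real_add)
  have arg_diff: "(a - b) / (1 + a * b) = 2 * of_real s * z / (z\<^sup>2 + 1)"
    unfolding prod diff using z z2 by (simp add: field_simps power2_eq_square)
  have arg_sum: "(a + b) / (1 - a * b) = 6 * of_real x * z / (z\<^sup>2 - 1)"
    unfolding prod sum using z z2 by (simp add: field_simps power2_eq_square)
  have binet: "of_real (poly (balancing_poly n) x) / z ^ n = 1 / (2 * of_real s) * (a ^ n - b ^ n)"
    "of_real (poly (lucas_balancing_poly n) x) / z ^ n = 1 / 2 * (a ^ n + b ^ n)" for n
  proof -
    have B: "poly (balancing_poly n) x = (l ^ n - m ^ n) / (2 * s)"
      using balancing_poly_binet[OF roots, of n] s(1) lm(3) by (simp add: field_simps)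
    have C: "poly (lucas_balancing_poly n) x = (l ^ n + m ^ n) / 2"
      using lucas_balancing_poly_binet[OF roots lm(2), of n] by simp
    show "of_real (poly (balancing_poly n) x) / z ^ n = 1 / (2 * of_real s) * (a ^ n - b ^ n)"
      unfolding B using z s(1) by (simp add: a_def b_def field_simps)
    show "of_real (poly (lucas_balancing_poly n) x) / z ^ n = 1 / 2 * (a ^ n + b ^ n)"
      unfolding C using z by (simp add: a_def b_def field_simps)
  qed
  \<comment> \<open>The second form of the series runs over odd exponents only, as the claimed sums
    do.\<close>
  note series = Arctan_series(2)[OF ab(1)] Arctan_series(2)[OF ab(2)]
  show ?thesis
    \<comment> \<open>The closed forms are read backwards, down to
      \<open>Arctan a - Arctan b\<close> and \<open>Arctan a + Arctan b\<close>, which leaves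
      termwise combinations of the two series.\<close>
    unfolding s_def[symmetric] binet arg_diff[symmetric] arg_sum[symmetric]
      Arctan_diff[OF ab, symmetric] Arctan_add[OF ab, symmetric]
    using sums_mult[OF sums_diff[OF series], of "1 / (2 * of_real s)"]
      sums_mult[OF sums_add[OF series], of "1 / 2"]
    by (simp only: ring_distribs mult.left_commute)
qed

end
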